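(* Let $H$ be an infinite-dimensional separable complex Hilbert space. Let $\Lambda\subseteq[0,\infty)$ be a bounded countable set, well-ordered by the usual order of $\mathbb{R}$, and let $(P_\lambda)_{\lambda\in\Lambda}$ be mutually orthogonal projections on $H$ with $\sum_{\lambda\in\Lambda}P_\lambda=I$ in the strong operator topology. Suppose that $F\in\mathcal{B}(H)$ is a self-adjoint finite rank operator with $FP_\lambda=P_\lambda F$ for all $\lambda\in\Lambda$. Then $$T=F+\sum_{\lambda\in\Lambda}\lambda P_\lambda$$ (series in the strong operator topology) belongs to $\mathcal{M}_r(H)$.
   Context: $\mathcal{B}(H)$ denotes the bounded linear operators on $H$; projections are orthogonal projections. For a nonzero Hilbert space $M$ and $A\in\mathcal{B}(M)$, the minimum modulus is $m(A)=\inf\{\|Ax\|: x\in M,\ \|x\|=1\}$; $A$ is minimum attaining if there is a unit vector $x_0\in M$ with $\|Ax_0\|=m(A)$. A closed subspace $M\subseteq H$ reduces $T\in\mathcal{B}(H)$ if $T(M)\subseteq M$ and $T^*(M)\subseteq M$. $\mathcal{M}_r(H)$ is the set of all $T\in\mathcal{B}(H)$ such that for every nonzero closed subspace $M$ reducing $T$, the restriction $T|_M:M\to M$ is minimum attaining. *)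

theory Defs
  imports "HOL-Analysis.Analysis"
begin

section \<open>Complex Hilbert spaces\<close>

class complex_vector = real_vector +
  fixes scaleC :: "complex \<Rightarrow> 'a \<Rightarrow> 'a" (infixr \<open>*\<^sub>C\<close> 75)
  assumes scaleC_add_right: "c *\<^sub>C (x + y) = c *\<^sub>C x + c *\<^sub>C y"
    and scaleC_add_left: "(c + d) *\<^sub>C x = c *\<^sub>C x + d *\<^sub>C x"
    and scaleC_scaleC: "c *\<^sub>C d *\<^sub>C x = (c * d) *\<^sub>C x"
    and scaleR_scaleC: "r *\<^sub>R x = complex_of_real r *\<^sub>C x"

global_interpretation complex_vector:
  vector_space "scaleC :: complex \<Rightarrow> 'a \<Rightarrow> 'a::complex_vector"
proof
  fix x :: 'a
  have "1 *\<^sub>R x = complex_of_real 1 *\<^sub>C x"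
    by (rule scaleR_scaleC)
  then show "1 *\<^sub>C x = x"
    by simp
qed (simp_all add: scaleC_add_right scaleC_add_left scaleC_scaleC)

text \<open>The inner product is conjugate-linear in the first and linear in the second argument.
  Building on the library class of real inner product spaces makes its norm and topology
  available; the norm satisfies \<open>(norm x)\<^sup>2 = x \<bullet> x = Re (cinner x x) = cinner x x\<close>.\<close>

class complex_inner = complex_vector + real_inner +
  fixes cinner :: "'a \<Rightarrow> 'a \<Rightarrow> complex"
  assumes cinner_commute: "cinner x y = cnj (cinner y x)"
    and cinner_add_right: "cinner x (y + z) = cinner x y + cinner x z"
    and cinner_scaleC_right: "cinner x (c *\<^sub>C y) = c * cinner x y"
    and inner_eq_Re_cinner: "x \<bullet> y = Re (cinner x y)"

class chilbert_space = complex_inner + complete_space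

definition cfinite_dim :: "'a::complex_vector set \<Rightarrow> bool"
  where "cfinite_dim V \<longleftrightarrow> (\<exists>B. finite B \<and> V \<subseteq> complex_vector.span B)"


section \<open>Bounded operators, adjoints and projections\<close>

definition bounded_clinear :: "('a::complex_inner \<Rightarrow> 'a) \<Rightarrow> bool"
  where "bounded_clinear T \<longleftrightarrow> bounded_linear T \<and> (\<forall>c x. T (c *\<^sub>C x) = c *\<^sub>C T x)"

definition cadjoint :: "('a::complex_inner \<Rightarrow> 'a) \<Rightarrow> 'a \<Rightarrow> 'a"
  where "cadjoint T = (THE S. \<forall>x y. cinner (S x) y = cinner x (T y))"

definition self_adjoint :: "('a::complex_inner \<Rightarrow> 'a) \<Rightarrow> bool"
  where "self_adjoint T \<longleftrightarrow> bounded_clinear T \<and> cadjoint T = T"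

definition orth_projection :: "('a::complex_inner \<Rightarrow> 'a) \<Rightarrow> bool"
  where "orth_projection P \<longleftrightarrow> self_adjoint P \<and> P \<circ> P = P"

definition finite_rank :: "('a::complex_inner \<Rightarrow> 'a) \<Rightarrow> bool"
  where "finite_rank T \<longleftrightarrow> cfinite_dim (range T)"

text \<open>The description in \<open>cadjoint\<close> is proper for bounded operators on Hilbert spaces,
  by the Riesz representation theorem.\<close>

lemma riesz_real:
  fixes g :: "'a::{real_inner, complete_space} \<Rightarrow> real"
  assumes g: "bounded_linear g"
  shows "\<exists>z. \<forall>y. g y = z \<bullet> y"
proof -
  interpret g: bounded_linear g by (fact g)
  define \<phi> where "\<phi> y = y \<bullet> y - 2 * g y" for y
  obtain K where K: "\<And>y. \<bar>g y\<bar> \<le> norm y * K"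
    using g.bounded by auto
  have lower: "- (K\<^sup>2) \<le> \<phi> y" for y
  proof -
    have "0 \<le> (norm y - K)\<^sup>2" by simp
    moreover have "g y \<le> norm y * K" using K[of y] by linarith
    ultimately show ?thesis
      by (simp add: \<phi>_def dot_square_norm power2_diff algebra_simps)
  qed
  define m where "m = Inf (range \<phi>)"
  have bdd: "bdd_below (range \<phi>)"
    using lower by (auto intro!: bdd_belowI[of _ "- (K\<^sup>2)"])
  have m_le: "m \<le> \<phi> y" for y
    unfolding m_def using bdd by (auto intro: cInf_lower)
  have "\<exists>y. \<phi> y < m + inverse (real (Suc n))" for n
    using cInf_less_iff[of "range \<phi>" "m + inverse (real (Suc n))"] bdd
    by (auto simp: m_def)
  then obtain a where a: "\<And>n. \<phi> (a n) < m + inverse (real (Suc n))"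
    by metis
  have par: "\<phi> x + \<phi> y - 2 * \<phi> ((1/2) *\<^sub>R (x + y)) = (norm (x - y))\<^sup>2 / 2" for x y
    by (simp add: \<phi>_def g.add g.scaleR power2_norm_eq_inner inner_add_left inner_add_right
        inner_diff_left inner_diff_right inner_commute[of y x] field_simps)
  have "Cauchy a"
  proof (rule metric_CauchyI)
    fix e :: real assume e: "0 < e"
    then have "0 < e\<^sup>2 / 4" by simp
    then obtain N where N: "inverse (real (Suc N)) < e\<^sup>2 / 4"
      using reals_Archimedean by blast
    have "dist (a i) (a j) < e" if "i \<ge> N" "j \<ge> N" for i j
    proof -
      have "inverse (real (Suc i)) \<le> inverse (real (Suc N))"
        "inverse (real (Suc j)) \<le> inverse (real (Suc N))"
        using that by (simp_all add: le_imp_inverse_le)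
      then have "(norm (a i - a j))\<^sup>2 < e\<^sup>2"
        using par[of "a i" "a j"] a[of i] a[of j] m_le[of "(1/2) *\<^sub>R (a i + a j)"] N by linarith
      then show ?thesis
        using e by (auto simp: dist_norm intro: power_less_imp_less_base)
    qed
    then show "\<exists>N. \<forall>i\<ge>N. \<forall>j\<ge>N. dist (a i) (a j) < e" by blast
  qed
  then obtain z where z: "a \<longlonglongrightarrow> z"
    using Cauchy_convergent_iff convergent_def by blast
  have "(\<lambda>n. \<phi> (a n)) \<longlonglongrightarrow> \<phi> z"
    unfolding \<phi>_def by (intro tendsto_intros z g.tendsto)
  moreover have "(\<lambda>n. m + inverse (real (Suc n))) \<longlonglongrightarrow> m + 0"
    by (intro tendsto_intros LIMSEQ_inverse_real_of_nat)
  ultimately have zm: "\<phi> z \<le> m"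
    using LIMSEQ_le[of "\<lambda>n. \<phi> (a n)" "\<phi> z" "\<lambda>n. m + inverse (real (Suc n))" "m + 0"] a
    by (auto intro: less_imp_le)
  have "g y = z \<bullet> y" for y
  proof (cases "y = 0")
    case False
    define d where "d = z \<bullet> y - g y"
    define t where "t = - d / (y \<bullet> y)"
    have p: "0 < y \<bullet> y" using False by simp
    have "\<phi> (z + t *\<^sub>R y) = \<phi> z + t\<^sup>2 * (y \<bullet> y) + 2 * t * d"
      by (simp add: \<phi>_def d_def g.add g.scaleR inner_add_left inner_add_right
          inner_commute[of y z] power2_eq_square algebra_simps)
    moreover have "t\<^sup>2 * (y \<bullet> y) + 2 * t * d = - (d\<^sup>2 / (y \<bullet> y))"
      using p by (simp add: t_def power2_eq_square field_simps)
    ultimately have "d\<^sup>2 / (y \<bullet> y) \<le> 0"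
      using m_le[of "z + t *\<^sub>R y"] zm by linarith
    then have "d\<^sup>2 \<le> 0"
      using p by (simp add: divide_le_0_iff)
    then show ?thesis by (simp add: d_def)
  qed (simp add: g.zero)
  then show ?thesis by blast
qed

lemma cinner_left_eqI:
  fixes u v :: "'a::complex_inner"
  assumes "\<And>y. cinner u y = cinner v y"
  shows "u = v"
proof -
  have "(u - v) \<bullet> (u - v) = u \<bullet> (u - v) - v \<bullet> (u - v)"
    by (rule inner_diff_left)
  also have "\<dots> = 0" by (simp add: inner_eq_Re_cinner assms)
  finally show ?thesis by simp
qed

lemma cinner_cadjoint_left:
  fixes T :: "'a::chilbert_space \<Rightarrow> 'a"
  assumes T: "bounded_clinear T"
  shows "cinner (cadjoint T x) y = cinner x (T y)"
proof -
  have lin: "bounded_linear T" and hom: "\<And>c x. T (c *\<^sub>C x) = c *\<^sub>C T x"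
    using T by (auto simp: bounded_clinear_def)
  have "\<exists>z. \<forall>y. cinner z y = cinner x (T y)" for x
  proof -
    have "bounded_linear (\<lambda>y. x \<bullet> T y)"
      by (rule bounded_linear_compose[OF bounded_linear_inner_right lin])
    then obtain z where z: "\<And>y. x \<bullet> T y = z \<bullet> y"
      using riesz_real by blast
    have re: "Re (cinner z y) = Re (cinner x (T y))" for y
      using z[of y] by (simp add: inner_eq_Re_cinner)
    have "Im (cinner z y) = Im (cinner x (T y))" for y
      using re[of "\<i> *\<^sub>C y"] by (simp add: hom cinner_scaleC_right)
    with re show ?thesis by (intro exI[of _ z] allI complex_eqI)
  qed
  then obtain S where S: "\<forall>x y. cinner (S x) y = cinner x (T y)" by metis
  have "\<exists>!S. \<forall>x y. cinner (S x) y = cinner x (T y)"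
  proof (rule ex1I)
    show "\<forall>x y. cinner (S x) y = cinner x (T y)" by (fact S)
    show "S' = S" if "\<forall>x y. cinner (S' x) y = cinner x (T y)" for S'
    proof (rule ext, rule cinner_left_eqI)
      show "cinner (S' x) y = cinner (S x) y" for x y
        by (simp only: S[rule_format] that[rule_format])
    qed
  qed
  from theI'[OF this, folded cadjoint_def] show ?thesis by simp
qed


section \<open>Minimum attaining operators and the class \<open>\<M>\<^sub>r(H)\<close>\<close>

text \<open>An operator on a subspace \<open>M\<close> is represented by any function on the whole space that
  agrees with it on \<open>M\<close>.\<close>

definition min_modulus_on :: "'a::complex_inner set \<Rightarrow> ('a \<Rightarrow> 'a) \<Rightarrow> real"
  where "min_modulus_on M A = (INF x\<in>{x \<in> M. norm x = 1}. norm (A x))"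

definition min_attaining_on :: "'a::complex_inner set \<Rightarrow> ('a \<Rightarrow> 'a) \<Rightarrow> bool"
  where "min_attaining_on M A \<longleftrightarrow> (\<exists>x\<^sub>0\<in>M. norm x\<^sub>0 = 1 \<and> norm (A x\<^sub>0) = min_modulus_on M A)"

definition reduces :: "'a::complex_inner set \<Rightarrow> ('a \<Rightarrow> 'a) \<Rightarrow> bool"
  where "reduces M T \<longleftrightarrow>
    complex_vector.subspace M \<and> closed M \<and> T ` M \<subseteq> M \<and> cadjoint T ` M \<subseteq> M"

definition min_attaining_reducing :: "('a::complex_inner \<Rightarrow> 'a) set" (\<open>\<M>\<^sub>r\<close>)
  where "\<M>\<^sub>r = {T. bounded_clinear T \<and> (\<forall>M. M \<noteq> {0} \<and> reduces M T \<longrightarrow> min_attaining_on M T)}"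

end

theory Submission
  imports Defs "HOL-Computational_Algebra.Fundamental_Theorem_Algebra"
begin

text \<open>
  Every \<open>P\<^sub>\<alpha>\<close> and \<open>F\<close> commute with \<open>T\<close>, hence leave the orthogonal complement \<open>N\<close> of all
  eigenvectors of \<open>T\<close> invariant. On the range of \<open>P\<^sub>\<alpha>\<close> the operator \<open>T\<close> is \<open>\<alpha> + F\<close>, so a nonzero \<open>N\<close>
  would contain an eigenvector, coming from the kernel of \<open>F\<close> or from its finite-dimensional range.
  Thus \<open>N = 0\<close>, and by projecting eigenvectors onto an invariant closed subspace \<open>M\<close> one sees that
  \<open>M\<close> is the closed span of the eigenvectors of \<open>T\<close> that it contains. All but finitely many eigenvalues
  of \<open>T\<close> lie in the well-ordered set \<open>\<Lambda>\<close>, so some eigenvalue on \<open>M\<close> has least modulus; this modulus is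
  the minimum modulus of \<open>T\<close> on \<open>M\<close>, attained at the eigenvector.
\<close>

section \<open>Symmetric operators with a total set of eigenvectors\<close>

text \<open>Minimise the squared distance to \<open>x\<close> over \<open>M\<close>: completeness
  provides a minimiser, and minimality forces orthogonality. The real inner product suffices, so the
  lemma also applies to closures of real spans of eigenvectors.\<close>

lemma exists_orthogonal_projection:
  fixes M :: "'a::{real_inner, complete_space} set"
  assumes M: "subspace M" "closed M"
  obtains p where "p \<in> M" "\<And>m. m \<in> M \<Longrightarrow> (x - p) \<bullet> m = 0"
proof -
  define \<phi> where "\<phi> y = (norm (x - y))\<^sup>2" for y
  define m where "m = Inf (\<phi> ` M)"
  have ne: "\<phi> ` M \<noteq> {}" using subspace_0[OF M(1)] by auto
  have bdd: "bdd_below (\<phi> ` M)"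
    by (auto simp: \<phi>_def intro!: bdd_belowI[of _ 0])
  have m_le: "m \<le> \<phi> y" if "y \<in> M" for y
    unfolding m_def using bdd that by (auto intro: cInf_lower)
  have "\<exists>y\<in>M. \<phi> y < m + inverse (real (Suc n))" for n
    using cInf_less_iff[OF ne bdd, of "m + inverse (real (Suc n))"] by (auto simp: m_def)
  then obtain a where aM: "\<And>n. a n \<in> M" and a: "\<And>n. \<phi> (a n) < m + inverse (real (Suc n))"
    by metis
  \<comment> \<open>Parallelogram law. Midpoints of points of \<open>M\<close> have
    \<open>\<phi>\<close> at least \<open>m\<close>, so two points of \<open>M\<close> whose values
    are near \<open>m\<close> are close to each other.\<close>
  have par: "\<phi> u + \<phi> v - 2 * \<phi> ((1/2) *\<^sub>R (u + v)) = (norm (u - v))\<^sup>2 / 2" for u v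
    by (simp add: \<phi>_def power2_norm_eq_inner inner_add_left inner_add_right
        inner_diff_left inner_diff_right inner_commute field_simps)
  have mid: "(1/2) *\<^sub>R (u + v) \<in> M" if "u \<in> M" "v \<in> M" for u v
    using that M(1) by (simp add: subspace_add subspace_scale)
  have "Cauchy a"
  proof (rule metric_CauchyI)
    fix e :: real assume e: "0 < e"
    then have "0 < e\<^sup>2 / 4" by simp
    then obtain N where N: "inverse (real (Suc N)) < e\<^sup>2 / 4"
      using reals_Archimedean by blast
    have "dist (a i) (a j) < e" if "i \<ge> N" "j \<ge> N" for i j
    proof -
      have "inverse (real (Suc i)) \<le> inverse (real (Suc N))"
        "inverse (real (Suc j)) \<le> inverse (real (Suc N))"
        using that by (simp_all add: le_imp_inverse_le)
      then have "(norm (a i - a j))\<^sup>2 < e\<^sup>2"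
        using par[of "a i" "a j"] a[of i] a[of j] m_le[OF mid[OF aM[of i] aM[of j]]] N
        by linarith
      then show ?thesis
        using e by (auto simp: dist_norm intro: power_less_imp_less_base)
    qed
    then show "\<exists>N. \<forall>i\<ge>N. \<forall>j\<ge>N. dist (a i) (a j) < e" by blast
  qed
  then obtain p where p: "a \<longlonglongrightarrow> p"
    using Cauchy_convergent_iff convergent_def by blast
  have pM: "p \<in> M"
    using M(2) aM p closed_sequentially by blast
  have "(\<lambda>n. \<phi> (a n)) \<longlonglongrightarrow> \<phi> p"
    unfolding \<phi>_def by (intro tendsto_intros p)
  moreover have "(\<lambda>n. m + inverse (real (Suc n))) \<longlonglongrightarrow> m + 0"
    by (intro tendsto_intros LIMSEQ_inverse_real_of_nat)
  ultimately have pm: "\<phi> p \<le> m"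
    using LIMSEQ_le[of "\<lambda>n. \<phi> (a n)" "\<phi> p" "\<lambda>n. m + inverse (real (Suc n))" "m + 0"] a
    by (auto intro: less_imp_le)
  have "(x - p) \<bullet> y = 0" if y: "y \<in> M" for y
  proof (cases "y = 0")
    case False
    define d where "d = (x - p) \<bullet> y"
    \<comment> \<open>This \<open>t\<close> minimises the quadratic in \<open>t\<close> given by
      \<open>\<phi> (p + t *\<^sub>R y)\<close>; the drop below \<open>\<phi> p\<close> is
      \<open>d\<^sup>2 / (y \<bullet> y)\<close>, which minimality of \<open>\<phi> p\<close> forces
      to be 0.\<close>
    define t where "t = d / (y \<bullet> y)"
    have q: "0 < y \<bullet> y" using False by simp
    have "\<phi> (p + t *\<^sub>R y) = \<phi> p + t\<^sup>2 * (y \<bullet> y) - 2 * t * d"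
      unfolding \<phi>_def d_def power2_norm_eq_inner
      by (simp add: inner_add_right inner_diff_left inner_diff_right inner_commute
          power2_eq_square algebra_simps)
    moreover have "t\<^sup>2 * (y \<bullet> y) - 2 * t * d = - (d\<^sup>2 / (y \<bullet> y))"
      using q by (simp add: t_def power2_eq_square field_simps)
    moreover have "p + t *\<^sub>R y \<in> M"
      using M(1) pM y by (simp add: subspace_add subspace_scale)
    ultimately have "d\<^sup>2 / (y \<bullet> y) \<le> 0"
      using m_le[of "p + t *\<^sub>R y"] pm by linarith
    then have "d\<^sup>2 \<le> 0"
      using q by (simp add: divide_le_0_iff)
    then show ?thesis by (simp add: d_def)
  qed simp
  with pM show thesis by (rule that)
qed

lemma closure_subspace:
  fixes S :: "'a::real_normed_vector set"
  assumes "subspace S"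
  shows "subspace (closure S)"
  unfolding subspace_def
proof (intro conjI ballI allI)
  show "0 \<in> closure S"
    using subspace_0[OF assms] closure_subset by blast
  fix x assume x: "x \<in> closure S"
  then obtain f where f: "\<And>n. f n \<in> S" "f \<longlonglongrightarrow> x"
    unfolding closure_sequential by blast
  show "c *\<^sub>R x \<in> closure S" for c
    unfolding closure_sequential using f assms
    by (intro exI[of _ "\<lambda>n. c *\<^sub>R f n"]) (auto intro: tendsto_intros subspace_scale)
  fix y assume "y \<in> closure S"
  then obtain g where g: "\<And>n. g n \<in> S" "g \<longlonglongrightarrow> y"
    unfolding closure_sequential by blast
  show "x + y \<in> closure S"
    unfolding closure_sequential using f g assms
    by (intro exI[of _ "\<lambda>n. f n + g n"]) (auto intro: tendsto_intros subspace_add)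
qed

text \<open>By Pythagoras both squared norms are weighted sums of the same squares, so it is enough
  to compare coefficients.\<close>

lemma norm_sum_scaleR_le_orthogonal:
  fixes v :: "'i \<Rightarrow> 'a::real_inner"
  assumes "finite I" "pairwise (\<lambda>i j. orthogonal (v i) (v j)) I"
    and c: "\<And>i. i \<in> I \<Longrightarrow> \<bar>c i\<bar> \<le> C" and "0 \<le> C"
  shows "norm (\<Sum>i\<in>I. c i *\<^sub>R v i) \<le> C * norm (\<Sum>i\<in>I. v i)"
proof (rule power2_le_imp_le)
  have "(norm (\<Sum>i\<in>I. c i *\<^sub>R v i))\<^sup>2 = (\<Sum>i\<in>I. (norm (c i *\<^sub>R v i))\<^sup>2)"
    using assms(1,2) by (intro norm_sum_Pythagorean) (auto simp: pairwise_def orthogonal_def)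
  also have "\<dots> = (\<Sum>i\<in>I. \<bar>c i\<bar>\<^sup>2 * (norm (v i))\<^sup>2)"
    by (simp add: power_mult_distrib)
  also have "\<dots> \<le> (\<Sum>i\<in>I. C\<^sup>2 * (norm (v i))\<^sup>2)"
    by (intro sum_mono mult_right_mono power_mono c) auto
  also have "\<dots> = (C * norm (\<Sum>i\<in>I. v i))\<^sup>2"
    by (simp add: norm_sum_Pythagorean[OF assms(1,2)] sum_distrib_left power_mult_distrib)
  finally show "(norm (\<Sum>i\<in>I. c i *\<^sub>R v i))\<^sup>2 \<le> (C * norm (\<Sum>i\<in>I. v i))\<^sup>2" .
qed (use \<open>0 \<le> C\<close> in simp)

text \<open>The counterpart from below. Indices with \<open>v i = 0\<close> are exempt because, in a
  decomposition indexed by real numbers, an index with zero component need not be an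
  eigenvalue.\<close>

lemma norm_sum_scaleR_ge_orthogonal:
  fixes v :: "'i \<Rightarrow> 'a::real_inner"
  assumes "finite I" "pairwise (\<lambda>i j. orthogonal (v i) (v j)) I"
    and c: "\<And>i. i \<in> I \<Longrightarrow> v i \<noteq> 0 \<Longrightarrow> C \<le> \<bar>c i\<bar>" and "0 \<le> C"
  shows "C * norm (\<Sum>i\<in>I. v i) \<le> norm (\<Sum>i\<in>I. c i *\<^sub>R v i)"
proof (rule power2_le_imp_le)
  have "(C * norm (\<Sum>i\<in>I. v i))\<^sup>2 = (\<Sum>i\<in>I. C\<^sup>2 * (norm (v i))\<^sup>2)"
    by (simp add: norm_sum_Pythagorean[OF assms(1,2)] sum_distrib_left power_mult_distrib)
  also have "\<dots> \<le> (\<Sum>i\<in>I. \<bar>c i\<bar>\<^sup>2 * (norm (v i))\<^sup>2)"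
  proof (rule sum_mono)
    show "C\<^sup>2 * (norm (v i))\<^sup>2 \<le> \<bar>c i\<bar>\<^sup>2 * (norm (v i))\<^sup>2" if "i \<in> I" for i
      using c[OF that] \<open>0 \<le> C\<close> by (cases "v i = 0") (simp, intro mult_right_mono power_mono, auto)
  qed
  also have "\<dots> = (norm (\<Sum>i\<in>I. c i *\<^sub>R v i))\<^sup>2"
    using assms(1,2)
    by (subst norm_sum_Pythagorean) (auto simp: pairwise_def orthogonal_def power_mult_distrib)
  finally show "(C * norm (\<Sum>i\<in>I. v i))\<^sup>2 \<le> (norm (\<Sum>i\<in>I. c i *\<^sub>R v i))\<^sup>2" .
qed simp

lemma eigenvectors_orthogonal:
  fixes T :: "'a::real_inner \<Rightarrow> 'a"
  assumes "\<And>x y. T x \<bullet> y = x \<bullet> T y"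
    and "T u = \<mu> *\<^sub>R u" "T v = \<nu> *\<^sub>R v" "\<mu> \<noteq> \<nu>"
  shows "orthogonal u v"
proof -
  have "\<mu> * (u \<bullet> v) = \<nu> * (u \<bullet> v)"
    using assms(1)[of u v] by (simp add: assms)
  with \<open>\<mu> \<noteq> \<nu>\<close> show ?thesis by (simp add: orthogonal_def)
qed

text \<open>Totality of eigenvectors passes from the whole space to \<open>M\<close>. The orthogonal
  complement \<open>C\<close> of the eigenvectors inside \<open>M\<close> is invariant by symmetry,
  so projecting any eigenvector of \<open>T\<close> onto \<open>C\<close> again gives a solution of
  the eigenvalue equation. It lies in \<open>M\<close>, is therefore orthogonal to itself, and
  vanishes. Hence \<open>C\<close> is orthogonal to all eigenvectors and is zero.\<close>

lemma eq_0_of_orthogonal_eigenvectors_in: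
  fixes T :: "'a::{real_inner, complete_space} \<Rightarrow> 'a"
  assumes T: "bounded_linear T" and sym: "\<And>x y. T x \<bullet> y = x \<bullet> T y"
    and total: "\<And>x. (\<And>e \<mu>. T e = \<mu> *\<^sub>R e \<Longrightarrow> x \<bullet> e = 0) \<Longrightarrow> x = 0"
    and M: "subspace M" "closed M" "T ` M \<subseteq> M"
    and x: "x \<in> M" "\<And>e \<mu>. e \<in> M \<Longrightarrow> T e = \<mu> *\<^sub>R e \<Longrightarrow> x \<bullet> e = 0"
  shows "x = 0"
proof (rule total)
  interpret T: bounded_linear T by fact
  define E where "E = {e \<in> M. \<exists>\<mu>. T e = \<mu> *\<^sub>R e}"
  define C where "C = M \<inter> (\<Inter>e\<in>E. {y. y \<bullet> e = 0})"
  have C_iff: "y \<in> C \<longleftrightarrow> y \<in> M \<and> (\<forall>e\<in>E. y \<bullet> e = 0)" for y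
    by (auto simp: C_def)
  have subC: "subspace C"
    using M(1) unfolding subspace_def by (auto simp: C_iff inner_add_left)
  have closedC: "closed C"
    unfolding C_def
    by (intro closed_Int closed_INT M(2) ballI closed_Collect_eq continuous_intros)
  have TC: "T y \<in> C" if "y \<in> C" for y
  proof -
    have "T y \<bullet> e = 0" if "e \<in> E" for e
      using that \<open>y \<in> C\<close> by (auto simp: C_iff E_def sym)
    then show ?thesis using \<open>y \<in> C\<close> M(3) by (auto simp: C_iff)
  qed
  fix e \<mu> assume e: "T e = \<mu> *\<^sub>R e"
  obtain p where p: "p \<in> C" "\<And>c. c \<in> C \<Longrightarrow> (e - p) \<bullet> c = 0"
    using exists_orthogonal_projection[OF subC closedC] by metis
  \<comment> \<open>\<open>w\<close> measures how far \<open>p\<close> is from satisfying the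
    eigenvalue equation. It lies in \<open>C\<close>, yet expressed through \<open>e - p\<close> it
    is orthogonal to \<open>C\<close>, by symmetry and invariance.\<close>
  define w where "w = T p - \<mu> *\<^sub>R p"
  have wC: "w \<in> C"
    unfolding w_def by (intro subspace_diff subspace_scale TC p(1) subC)
  have "w = \<mu> *\<^sub>R (e - p) - T (e - p)"
    by (simp add: w_def T.diff e algebra_simps)
  then have "w \<bullet> w = (\<mu> *\<^sub>R (e - p) - T (e - p)) \<bullet> w" by simp
  also have "\<dots> = \<mu> * ((e - p) \<bullet> w) - (e - p) \<bullet> T w"
    by (simp only: inner_diff_left[of "\<mu> *\<^sub>R (e - p)"] inner_scaleR_left sym)
  also have "\<dots> = 0"
    using p(2)[OF wC] p(2)[OF TC[OF wC]] by simp
  finally have "T p = \<mu> *\<^sub>R p" by (simp add: w_def)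
  then have "p \<in> E" using p(1) by (auto simp: E_def C_iff)
  then have "p \<bullet> p = 0" using p(1) by (auto simp: C_iff)
  moreover have "x \<in> C" using x by (auto simp: C_iff E_def)
  ultimately show "x \<bullet> e = 0" using p(2)[of x] by (simp add: inner_commute)
qed

text \<open>Terms are grouped by eigenvalue, so that for symmetric \<open>T\<close> the summands
  become pairwise orthogonal and Pythagoras applies.\<close>

lemma span_eigenvectors_decomposition:
  fixes T :: "'a::real_inner \<Rightarrow> 'a"
  assumes T: "linear T" and M: "subspace M"
    and x: "x \<in> span {e \<in> M. \<exists>\<mu>. T e = \<mu> *\<^sub>R e}"
  obtains I v where "finite I" "\<And>\<mu>. v \<mu> \<in> M" "\<And>\<mu>. T (v \<mu>) = \<mu> *\<^sub>R v \<mu>" "x = (\<Sum>\<mu>\<in>I. v \<mu>)"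
proof -
  interpret T: linear T by fact
  have "\<exists>v. finite {\<mu>. v \<mu> \<noteq> 0} \<and> (\<forall>\<mu>. v \<mu> \<in> M \<and> T (v \<mu>) = \<mu> *\<^sub>R v \<mu>) \<and> x = (\<Sum>\<mu> | v \<mu> \<noteq> 0. v \<mu>)"
    using x
  proof (induction rule: span_induct_alt)
    case base
    show ?case by (intro exI[of _ "\<lambda>_. 0"]) (simp add: subspace_0[OF M] T.zero)
  next
    case (step c e y)
    then obtain \<nu> v where e: "e \<in> M" "T e = \<nu> *\<^sub>R e" and fin: "finite {\<mu>. v \<mu> \<noteq> 0}"
      and v: "\<forall>\<mu>. v \<mu> \<in> M \<and> T (v \<mu>) = \<mu> *\<^sub>R v \<mu>" and y: "y = (\<Sum>\<mu> | v \<mu> \<noteq> 0. v \<mu>)"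
      by auto
    define w where "w \<mu> = v \<mu> + (if \<mu> = \<nu> then c *\<^sub>R e else 0)" for \<mu>
    let ?I = "insert \<nu> {\<mu>. v \<mu> \<noteq> 0}"
    have sub: "{\<mu>. w \<mu> \<noteq> 0} \<subseteq> ?I" by (auto simp: w_def)
    have "(\<Sum>\<mu> | w \<mu> \<noteq> 0. w \<mu>) = (\<Sum>\<mu>\<in>?I. w \<mu>)"
      using fin sub by (intro sum.mono_neutral_left) auto
    also have "\<dots> = (\<Sum>\<mu>\<in>?I. v \<mu>) + c *\<^sub>R e"
      unfolding w_def using fin by (simp add: sum.distrib sum.delta' del: sum.insert)
    also have "(\<Sum>\<mu>\<in>?I. v \<mu>) = y"
      unfolding y using fin by (intro sum.mono_neutral_right) auto
    finally have "c *\<^sub>R e + y = (\<Sum>\<mu> | w \<mu> \<noteq> 0. w \<mu>)" by simp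
    moreover have "w \<mu> \<in> M \<and> T (w \<mu>) = \<mu> *\<^sub>R w \<mu>" for \<mu>
      using v e M by (auto simp: w_def T.add T.scale algebra_simps intro: subspace_add subspace_scale)
    ultimately show ?case using finite_subset[OF sub] fin by blast
  qed
  then show thesis using that by blast
qed

text \<open>On finite sums of eigenvectors in \<open>M\<close> the bound is Pythagoras. These sums
  are dense in \<open>M\<close>, since the remainder after projecting onto their closure is
  orthogonal to every eigenvector in \<open>M\<close>; continuity then extends the bound.\<close>

lemma lower_bound_of_eigenvalues:
  fixes T :: "'a::{real_inner, complete_space} \<Rightarrow> 'a"
  assumes T: "bounded_linear T" and sym: "\<And>x y. T x \<bullet> y = x \<bullet> T y"
    and total: "\<And>x. (\<And>e \<mu>. T e = \<mu> *\<^sub>R e \<Longrightarrow> x \<bullet> e = 0) \<Longrightarrow> x = 0"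
    and M: "subspace M" "closed M" "T ` M \<subseteq> M"
    and c: "0 \<le> c" "\<And>e \<mu>. e \<in> M \<Longrightarrow> e \<noteq> 0 \<Longrightarrow> T e = \<mu> *\<^sub>R e \<Longrightarrow> c \<le> \<bar>\<mu>\<bar>"
    and x: "x \<in> M"
  shows "c * norm x \<le> norm (T x)"
proof -
  interpret T: bounded_linear T by fact
  define E where "E = {e \<in> M. \<exists>\<mu>. T e = \<mu> *\<^sub>R e}"
  have bound: "c * norm y \<le> norm (T y)" if "y \<in> span E" for y
  proof -
    obtain I v where v: "finite I" "\<And>\<mu>. v \<mu> \<in> M" "\<And>\<mu>. T (v \<mu>) = \<mu> *\<^sub>R v \<mu>"
      and y: "y = (\<Sum>\<mu>\<in>I. v \<mu>)"
      using span_eigenvectors_decomposition[OF T.linear M(1) \<open>y \<in> span E\<close>[unfolded E_def]]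
      by metis
    have "c * norm (\<Sum>\<mu>\<in>I. v \<mu>) \<le> norm (\<Sum>\<mu>\<in>I. \<mu> *\<^sub>R v \<mu>)"
      using v c by (intro norm_sum_scaleR_ge_orthogonal)
        (auto simp: pairwise_def intro: eigenvectors_orthogonal[OF sym])
    then show ?thesis by (simp add: y T.sum v(3))
  qed
  have "span E \<subseteq> M" using M(1) by (intro span_minimal) (auto simp: E_def)
  then have EM: "closure (span E) \<subseteq> M" using M(2) by (rule closure_minimal)
  obtain p where p: "p \<in> closure (span E)" "\<And>m. m \<in> closure (span E) \<Longrightarrow> (x - p) \<bullet> m = 0"
    using exists_orthogonal_projection[OF closure_subspace[OF subspace_span] closed_closure]
    by metis
  have "x - p = 0"
  proof (rule eq_0_of_orthogonal_eigenvectors_in[OF T sym total M])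
    show "x - p \<in> M" using p(1) EM x M(1) by (auto intro: subspace_diff)
    show "(x - p) \<bullet> e = 0" if "e \<in> M" "T e = \<mu> *\<^sub>R e" for e \<mu>
      using that by (intro p(2)) (auto simp: E_def intro!: subsetD[OF closure_subset] span_base)
  qed
  then have "x \<in> closure (span E)" using p(1) by simp
  also have "\<dots> \<subseteq> {y. c * norm y \<le> norm (T y)}"
    using bound by (intro closure_minimal closed_Collect_le continuous_intros
        T.continuous_on) auto
  finally show ?thesis by simp
qed

text \<open>Choosing one eigenvector for each eigenvalue gives an orthogonal, hence independent,
  family inside a finitely spanned space.\<close>

lemma finite_eigenvalues:
  fixes T :: "'a::real_inner \<Rightarrow> 'a"
  assumes sym: "\<And>x y. T x \<bullet> y = x \<bullet> T y" and B: "finite B" "V \<subseteq> span B"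
  shows "finite {\<mu>. \<exists>e\<in>V. e \<noteq> 0 \<and> T e = \<mu> *\<^sub>R e}" (is "finite ?S")
proof -
  have "\<forall>\<mu>\<in>?S. \<exists>e. e \<in> V \<and> e \<noteq> 0 \<and> T e = \<mu> *\<^sub>R e" by blast
  from bchoice[OF this] obtain e
    where e: "\<And>\<mu>. \<mu> \<in> ?S \<Longrightarrow> e \<mu> \<in> V \<and> e \<mu> \<noteq> 0 \<and> T (e \<mu>) = \<mu> *\<^sub>R e \<mu>"
    by blast
  have orth: "orthogonal (e \<mu>) (e \<nu>)" if "\<mu> \<in> ?S" "\<nu> \<in> ?S" "\<mu> \<noteq> \<nu>" for \<mu> \<nu>
    using e that by (intro eigenvectors_orthogonal[OF sym]) blast+
  then have "pairwise orthogonal (e ` ?S)" by (intro pairwise_imageI)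
  moreover have "0 \<notin> e ` ?S"
  proof
    assume "0 \<in> e ` ?S"
    then obtain \<mu> where "\<mu> \<in> ?S" "0 = e \<mu>" by (rule imageE)
    then show False using e[of \<mu>] by simp
  qed
  ultimately have "independent (e ` ?S)" by (rule pairwise_orthogonal_independent)
  moreover have "e ` ?S \<subseteq> span B" using e B(2) by blast
  ultimately have "finite (e ` ?S)" by (rule conjunct1[OF independent_span_bound[OF B(1)]])
  moreover have "inj_on e ?S"
  proof (rule inj_onI, rule ccontr)
    fix \<mu> \<nu> assume *: "\<mu> \<in> ?S" "\<nu> \<in> ?S" "e \<mu> = e \<nu>" "\<mu> \<noteq> \<nu>"
    have "orthogonal (e \<mu>) (e \<nu>)" using orth[OF *(1,2,4)] .
    then have "e \<nu> = 0" unfolding *(3) by (simp only: orthogonal_self)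
    with e[OF *(2)] show False by blast
  qed
  ultimately show ?thesis by (simp add: finite_image_iff)
qed

text \<open>Orthogonality bounds distances between weighted partial sums by \<open>C\<close> times
  those between unweighted ones, so the Cauchy property carries over without absolute
  convergence.\<close>

lemma summable_on_scaleR_orthogonal:
  fixes v :: "'i \<Rightarrow> 'a::{real_inner, complete_space}"
  assumes v: "(v has_sum x) A" and orth: "pairwise (\<lambda>i j. orthogonal (v i) (v j)) A"
    and c: "\<And>i. i \<in> A \<Longrightarrow> \<bar>c i\<bar> \<le> C" and "0 \<le> C"
  shows "(\<lambda>i. c i *\<^sub>R v i) summable_on A"
    and "norm (\<Sum>\<^sub>\<infinity>i\<in>A. c i *\<^sub>R v i) \<le> C * norm x"
proof -
  let ?g = "\<lambda>i. c i *\<^sub>R v i"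
  let ?F = "finite_subsets_at_top A"
  have bound: "norm (sum ?g B) \<le> C * norm (sum v B)" if "finite B" "B \<subseteq> A" for B
    using that c \<open>0 \<le> C\<close> by (intro norm_sum_scaleR_le_orthogonal pairwise_subset[OF orth]) auto
  have diff: "sum f B1 - sum f B2 = sum f (B1 - B2) - sum f (B2 - B1)"
    if "finite B1" "finite B2" for f :: "'i \<Rightarrow> 'a" and B1 B2
  proof -
    have "sum f B1 = sum f (B1 \<inter> B2) + sum f (B1 - B2)"
      using that(1) by (rule sum.Int_Diff)
    moreover have "sum f B2 = sum f (B1 \<inter> B2) + sum f (B2 - B1)"
      using that by (metis Int_commute sum.Int_Diff)
    ultimately show ?thesis by simp
  qed
  have dist_bound: "dist (sum ?g B1) (sum ?g B2) \<le> C * dist (sum v B1) (sum v B2)"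
    if B: "finite B1" "finite B2" "B1 \<subseteq> A" "B2 \<subseteq> A" for B1 B2
  proof -
    \<comment> \<open>Signs turn the difference of two finite sums into one sum over the symmetric
      difference, and they preserve orthogonality.\<close>
    define s where "s i = (if i \<in> B1 then 1 else -1 :: real)" for i
    let ?D = "(B1 - B2) \<union> (B2 - B1)"
    have s: "sum f B1 - sum f B2 = (\<Sum>i\<in>?D. s i *\<^sub>R f i)" for f :: "'i \<Rightarrow> 'a"
      unfolding diff[OF B(1,2)] using B
      by (subst sum.union_disjoint) (auto simp: s_def sum_negf)
    have "norm (\<Sum>i\<in>?D. c i *\<^sub>R (s i *\<^sub>R v i)) \<le> C * norm (\<Sum>i\<in>?D. s i *\<^sub>R v i)"
      using B c \<open>0 \<le> C\<close>
      by (intro norm_sum_scaleR_le_orthogonal pairwise_mono[OF orth]) (auto simp: orthogonal_def)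
    then show ?thesis
      by (simp only: dist_norm s scaleR_scaleR mult.commute)
  qed
  have ev: "\<forall>\<^sub>F B in ?F. finite B \<and> B \<subseteq> A"
    by (auto intro: eventually_finite_subsets_at_top_weakI)
  have "cauchy_filter (filtermap (sum ?g) ?F)"
    unfolding cauchy_filter_metric_filtermap
  proof (intro allI impI)
    fix e :: real assume e: "0 < e"
    \<comment> \<open>Taking \<open>C + 1\<close> keeps the divisor positive when
      \<open>C = 0\<close> and makes the final estimate strict.\<close>
    define k where "k = C + 1"
    define d where "d = e / (2 * k)"
    have k: "0 < k" using \<open>0 \<le> C\<close> by (simp add: k_def)
    then have d: "0 < d" using e by (simp add: d_def)
    have "\<forall>\<^sub>F B in ?F. dist (sum v B) x < d"
      using v d unfolding has_sum_def tendsto_iff by blast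
    with ev have "\<forall>\<^sub>F B in ?F. (finite B \<and> B \<subseteq> A) \<and> dist (sum v B) x < d"
      by (rule eventually_conj)
    moreover have "dist (sum ?g B1) (sum ?g B2) < e"
      if "(finite B1 \<and> B1 \<subseteq> A) \<and> dist (sum v B1) x < d"
        "(finite B2 \<and> B2 \<subseteq> A) \<and> dist (sum v B2) x < d" for B1 B2
    proof -
      have "dist (sum v B1) (sum v B2) \<le> 2 * d"
        using that dist_triangle2[of "sum v B1" "sum v B2" x] by linarith
      then have "dist (sum ?g B1) (sum ?g B2) \<le> C * (2 * d)"
        using dist_bound[of B1 B2] that \<open>0 \<le> C\<close> by (meson mult_left_mono order_trans)
      also have "\<dots> < k * (2 * d)" using d by (simp add: k_def)
      also have "\<dots> = e" using k by (simp add: d_def)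
      finally show ?thesis .
    qed
    ultimately show "\<exists>P. eventually P ?F \<and> (\<forall>B1 B2. P B1 \<and> P B2 \<longrightarrow> dist (sum ?g B1) (sum ?g B2) < e)"
      by (intro exI[of _ "\<lambda>B. (finite B \<and> B \<subseteq> A) \<and> dist (sum v B) x < d"]) auto
  qed
  moreover have "complete (UNIV :: 'a set)"
    by (meson Cauchy_convergent UNIV_I complete_def convergent_def)
  ultimately obtain L where "(sum ?g \<longlongrightarrow> L) ?F"
    using complete_uniform[where S="UNIV :: 'a set"] by (force simp: filterlim_def)
  then show g: "?g summable_on A" unfolding summable_on_def has_sum_def by blast
  show "norm (infsum ?g A) \<le> C * norm x"
  proof (rule tendsto_le)
    show "((\<lambda>B. C * norm (sum v B)) \<longlongrightarrow> C * norm x) ?F"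
      using v unfolding has_sum_def by (intro tendsto_intros)
    show "((\<lambda>B. norm (sum ?g B)) \<longlongrightarrow> norm (infsum ?g A)) ?F"
      using has_sum_infsum[OF g] unfolding has_sum_def by (intro tendsto_intros)
    show "\<forall>\<^sub>F B in ?F. norm (sum ?g B) \<le> C * norm (sum v B)"
      using ev by eventually_elim (use bound in blast)
  qed simp
qed

section \<open>Self-adjoint operators on complex spaces\<close>

lemma cinner_scaleC_left: "cinner (c *\<^sub>C x) y = cnj c * cinner x y"
  by (metis cinner_commute cinner_scaleC_right complex_cnj_mult)

lemma inner_scaleC_left: "(c *\<^sub>C x) \<bullet> (y :: 'a::complex_inner) = x \<bullet> (cnj c *\<^sub>C y)"
  by (simp add: inner_eq_Re_cinner cinner_scaleC_left cinner_scaleC_right)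

lemma norm_scaleC: "norm (c *\<^sub>C x) = cmod c * norm (x :: 'a::complex_inner)"
proof (rule power2_eq_imp_eq)
  have "(norm (c *\<^sub>C x))\<^sup>2 = x \<bullet> ((c * cnj c) *\<^sub>C x)"
    by (simp add: power2_norm_eq_inner inner_scaleC_left mult.commute)
  also have "c * cnj c = complex_of_real ((cmod c)\<^sup>2)"
    by (rule complex_norm_square[symmetric])
  also have "x \<bullet> (complex_of_real ((cmod c)\<^sup>2) *\<^sub>C x) = (cmod c * norm x)\<^sup>2"
    by (simp only: scaleR_scaleC[symmetric] inner_scaleR_right power_mult_distrib power2_norm_eq_inner[of x])
  finally show "(norm (c *\<^sub>C x))\<^sup>2 = (cmod c * norm x)\<^sup>2" .
qed simp_all

lemma bounded_linear_scaleC: "bounded_linear (\<lambda>x :: 'a::complex_inner. c *\<^sub>C x)"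
  by (rule bounded_linear_intro[where K = "cmod c"])
    (simp_all add: scaleC_add_right scaleR_scaleC mult.commute norm_scaleC)

lemma self_adjoint_cinner:
  fixes T :: "'a::chilbert_space \<Rightarrow> 'a"
  assumes "self_adjoint T"
  shows "cinner (T x) y = cinner x (T y)"
  using assms cinner_cadjoint_left[of T x y] by (simp add: self_adjoint_def)

lemma self_adjoint_inner:
  fixes T :: "'a::chilbert_space \<Rightarrow> 'a"
  assumes "self_adjoint T"
  shows "T x \<bullet> y = x \<bullet> T y"
  by (simp add: inner_eq_Re_cinner self_adjoint_cinner[OF assms])

text \<open>Moving \<open>T\<close> across \<open>cinner e e\<close> shows \<open>cnj a = a\<close>.
  This links complex eigenvectors to the real eigenvalue equation used in the preceding
  section.\<close>

lemma self_adjoint_eigenvalue_real: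
  fixes T :: "'a::chilbert_space \<Rightarrow> 'a"
  assumes "self_adjoint T" "T e = a *\<^sub>C e" "e \<noteq> 0"
  shows "T e = Re a *\<^sub>R e"
proof -
  have "Re (cinner e e) \<noteq> 0"
    using \<open>e \<noteq> 0\<close> by (simp flip: inner_eq_Re_cinner)
  moreover have "cnj a * cinner e e = a * cinner e e"
    using self_adjoint_cinner[OF assms(1), of e e]
    by (simp add: assms(2) cinner_scaleC_left cinner_scaleC_right)
  ultimately have "cnj a = a" by auto
  then have "complex_of_real (Re a) = a" by (simp add: complex_eq_iff)
  then show ?thesis by (simp add: assms(2) scaleR_scaleC)
qed

lemma complex_subspace_imp_subspace: "complex_vector.subspace S \<Longrightarrow> subspace S"
  by (simp add: subspace_def complex_vector.subspace_def scaleR_scaleC)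

text \<open>Splitting each coefficient into real and imaginary parts turns finite complex dimension
  into finite real dimension.\<close>

lemma complex_span_subset_span:
  "complex_vector.span B \<subseteq> span (B \<union> (*\<^sub>C) \<i> ` B)" (is "_ \<subseteq> span ?B")
proof
  fix x assume "x \<in> complex_vector.span B"
  then show "x \<in> span ?B"
  proof (induction rule: complex_vector.span_induct_alt)
    case base
    show ?case by (rule span_zero)
  next
    case (step c b y)
    have "c *\<^sub>C b = Re c *\<^sub>R b + Im c *\<^sub>R (\<i> *\<^sub>C b)"
      by (simp add: scaleR_scaleC scaleC_scaleC flip: scaleC_add_left)
        (simp add: complex_eq mult.commute)
    moreover have "Re c *\<^sub>R b + Im c *\<^sub>R (\<i> *\<^sub>C b) \<in> span ?B"
      using step.hyps by (intro span_add span_scale span_base) auto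
    ultimately show ?case using step.IH by (simp add: span_add)
  qed
qed

lemma cfinite_dim_real_span:
  assumes "cfinite_dim V"
  obtains B where "finite B" "V \<subseteq> span B"
proof -
  obtain B where B: "finite B" "V \<subseteq> complex_vector.span B"
    using assms by (auto simp: cfinite_dim_def)
  show thesis
  proof (rule that)
    show "finite (B \<union> (*\<^sub>C) \<i> ` B)" using B(1) by simp
    show "V \<subseteq> span (B \<union> (*\<^sub>C) \<i> ` B)" using B(2) complex_span_subset_span by blast
  qed
qed

text \<open>Among the first \<open>card B + 1\<close> terms either all are distinct, and their
  number exceeds the dimension, or two coincide, and their difference is the relation.\<close>

lemma exists_linear_relation:
  fixes f :: "nat \<Rightarrow> 'a::complex_vector"
  assumes B: "finite B" "range f \<subseteq> complex_vector.span B"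
  obtains n c j where "j \<le> n" "c j \<noteq> 0" "(\<Sum>i\<le>n. c i *\<^sub>C f i) = 0"
proof -
  let ?n = "card B"
  show thesis
  proof (cases "inj_on f {..?n}")
    case True
    have "complex_vector.dependent (f ` {..?n})"
    proof (rule ccontr)
      assume "complex_vector.independent (f ` {..?n})"
      then have "card (f ` {..?n}) \<le> ?n"
        using B complex_vector.independent_span_bound[of B "f ` {..?n}"] by blast
      then show False using True by (simp add: card_image)
    qed
    then obtain u v where u: "v \<in> f ` {..?n}" "u v \<noteq> 0" "(\<Sum>v\<in>f ` {..?n}. u v *\<^sub>C v) = 0"
      by (auto simp: complex_vector.dependent_finite)
    then obtain j where "j \<le> ?n" "u (f j) \<noteq> 0" by auto
    moreover have "(\<Sum>i\<le>?n. u (f i) *\<^sub>C f i) = 0"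
      using u(3) by (simp add: sum.reindex[OF True])
    ultimately show thesis by (rule that[of j ?n "\<lambda>i. u (f i)"])
  next
    case False
    then obtain i j where ij: "i \<le> ?n" "j \<le> ?n" "i \<noteq> j" "f i = f j"
      by (auto simp: inj_on_def)
    define c :: "nat \<Rightarrow> complex" where "c k = (if k = i then 1 else 0) - (if k = j then 1 else 0)" for k
    have "(\<Sum>k\<le>?n. c k *\<^sub>C f k)
        = (\<Sum>k\<le>?n. (if k = i then f k else 0)) - (\<Sum>k\<le>?n. (if k = j then f k else 0))"
      unfolding c_def sum_subtractf[symmetric]
      by (intro sum.cong) (auto simp: complex_vector.scale_left_diff_distrib)
    also have "\<dots> = 0" using ij by (simp add: sum.delta)
    finally show thesis using ij by (intro that[of i ?n c]) (auto simp: c_def)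
  qed
qed

text \<open>Among nonzero polynomials with \<open>p(T) x = 0\<close> take one of least degree.
  Splitting off a root \<open>a\<close> leaves a cofactor \<open>q\<close>, and
  \<open>q(T) x\<close> is nonzero by minimality and killed by \<open>T - a\<close>.\<close>

lemma exists_eigenvector:
  fixes T :: "'a::complex_vector \<Rightarrow> 'a"
  assumes add: "\<And>x y. T (x + y) = T x + T y" and scale: "\<And>c x. T (c *\<^sub>C x) = c *\<^sub>C T x"
    and S: "complex_vector.subspace S" "T ` S \<subseteq> S" "cfinite_dim S"
    and x: "x \<in> S" "x \<noteq> 0"
  obtains e a where "e \<in> S" "e \<noteq> 0" "T e = a *\<^sub>C e"
proof -
  have T0: "T 0 = 0" using scale[of 0 0] by simp
  \<comment> \<open>\<open>f p\<close> is the vector \<open>p(T) x\<close>, evaluated by Horner's scheme.\<close>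
  define f where "f p = fold_coeffs (\<lambda>a y. a *\<^sub>C x + T y) p 0" for p
  have f0: "f 0 = 0" by (simp add: f_def)
  \<comment> \<open>The recursion includes the degenerate case \<open>pCons 0 0 = 0\<close>, thanks
    to \<open>T 0 = 0\<close>.\<close>
  have fp: "f (pCons a p) = a *\<^sub>C x + T (f p)" for a p
    by (cases "p = 0"; cases "a = 0") (simp_all add: f_def T0)
  have f_add: "f (p + q) = f p + f q" for p q
    by (induction p q rule: poly_induct2)
      (simp_all add: f0 fp add scaleC_add_left)
  have f_smult: "f (smult c p) = c *\<^sub>C f p" for c p
    by (induction p) (simp_all add: f0 fp scale scaleC_add_right scaleC_scaleC)
  have f_monom: "f (monom c i) = c *\<^sub>C (T ^^ i) x" for c i
    by (induction i) (simp_all add: monom_0 monom_Suc f0 fp T0 scale)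
  have f_sum: "f (\<Sum>i\<in>I. g i) = (\<Sum>i\<in>I. f (g i))" for I and g :: "nat \<Rightarrow> complex poly"
    by (induction I rule: infinite_finite_induct) (simp_all add: f0 f_add)
  have fS: "f p \<in> S" for p
    by (induction p) (use S x in \<open>auto simp: f0 fp intro!: complex_vector.subspace_add
        complex_vector.subspace_scale complex_vector.subspace_0\<close>)
  obtain B where B: "finite B" "S \<subseteq> complex_vector.span B"
    using S(3) by (auto simp: cfinite_dim_def)
  have "range (\<lambda>i. (T ^^ i) x) \<subseteq> S"
    using fS[of "monom 1 _"] by (auto simp: f_monom)
  then have "range (\<lambda>i. (T ^^ i) x) \<subseteq> complex_vector.span B" using B(2) by (rule subset_trans)
  then obtain n c j where c: "j \<le> n" "c j \<noteq> 0" "(\<Sum>i\<le>n. c i *\<^sub>C (T ^^ i) x) = 0"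
    by (rule exists_linear_relation[OF B(1)])
  define p0 where "p0 = (\<Sum>i\<le>n. monom (c i) i)"
  have "coeff p0 j \<noteq> 0" using c by (simp add: p0_def coeff_sum)
  then have "p0 \<noteq> 0 \<and> f p0 = 0" using c(3) by (auto simp: p0_def f_sum f_monom)
  from ex_has_least_nat[of "\<lambda>p. p \<noteq> 0 \<and> f p = 0", OF this, of degree]
  obtain p where p: "p \<noteq> 0" "f p = 0"
    and min: "\<And>q. q \<noteq> 0 \<Longrightarrow> f q = 0 \<Longrightarrow> degree p \<le> degree q" by blast
  have "degree p \<noteq> 0"
  proof
    assume "degree p = 0"
    then obtain b where "p = [:b:]" by (rule degree_eq_zeroE)
    then show False using p x by (simp add: fp f0 T0)
  qed
  then have "\<not> constant (poly p)" by (simp add: constant_degree)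
  then obtain a where "poly p a = 0" using fundamental_theorem_of_algebra by blast
  then obtain q where q: "p = [:-a, 1:] * q" by (auto simp: poly_eq_0_iff_dvd)
  then have "q \<noteq> 0" using p by auto
  then have "degree q < degree p" by (simp add: q degree_mult_eq del: mult_pCons_left)
  then have "f q \<noteq> 0" using min[of q] \<open>q \<noteq> 0\<close> by auto
  moreover have "T (f q) = a *\<^sub>C f q"
  proof -
    \<comment> \<open>\<open>pCons 0 q\<close> is the variable times \<open>q\<close>, on which
      \<open>f\<close> gives \<open>T (f q)\<close>.\<close>
    have "f p = f (smult (-a) q) + f (pCons 0 q)" by (simp add: q flip: f_add)
    then show ?thesis using p(2) by (simp only: f_smult fp) simp
  qed
  ultimately show thesis using fS by (intro that) auto
qed

section \<open>Perturbation of a diagonal operator\<close>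

theorem proposition5p1:
  fixes \<Lambda> :: "real set"
    and P :: "real \<Rightarrow> 'h::chilbert_space \<Rightarrow> 'h"
    and F :: "'h \<Rightarrow> 'h"
  assumes "\<not> cfinite_dim (UNIV :: 'h set)"
    and "separable_space (euclidean :: 'h topology)"
    and "\<Lambda> \<subseteq> {0..}" and "bounded \<Lambda>" and "countable \<Lambda>"
    and "well_order_on \<Lambda> {(\<alpha>, \<beta>). \<alpha> \<in> \<Lambda> \<and> \<beta> \<in> \<Lambda> \<and> \<alpha> \<le> \<beta>}"
    and "\<And>\<alpha>. \<alpha> \<in> \<Lambda> \<Longrightarrow> orth_projection (P \<alpha>)"
    and "\<And>\<alpha> \<beta>. \<alpha> \<in> \<Lambda> \<Longrightarrow> \<beta> \<in> \<Lambda> \<Longrightarrow> \<alpha> \<noteq> \<beta> \<Longrightarrow> P \<alpha> \<circ> P \<beta> = (\<lambda>x. 0)"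
    and "\<And>x. ((\<lambda>\<alpha>. P \<alpha> x) has_sum x) \<Lambda>"
    and "self_adjoint F" and "finite_rank F"
    and "\<And>\<alpha>. \<alpha> \<in> \<Lambda> \<Longrightarrow> F \<circ> P \<alpha> = P \<alpha> \<circ> F"
  shows "(\<forall>x. (\<lambda>\<alpha>. \<alpha> *\<^sub>R P \<alpha> x) summable_on \<Lambda>) \<and>
    (\<lambda>x. F x + (\<Sum>\<^sub>\<infinity>\<alpha>\<in>\<Lambda>. \<alpha> *\<^sub>R P \<alpha> x)) \<in> \<M>\<^sub>r"
proof -

  \<comment> \<open>The projections and their commutation with \<open>F\<close>\<close>
  note P_sum = assms(9)
  have P_sa: "self_adjoint (P \<alpha>)" and P_idem: "P \<alpha> (P \<alpha> x) = P \<alpha> x" if "\<alpha> \<in> \<Lambda>" for \<alpha> x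
    using assms(7)[OF that] by (auto simp: orth_projection_def fun_eq_iff)
  have P_lin: "bounded_linear (P \<alpha>)" and P_scaleC: "P \<alpha> (c *\<^sub>C x) = c *\<^sub>C P \<alpha> x"
    if "\<alpha> \<in> \<Lambda>" for \<alpha> c x
    using P_sa[OF that] by (auto simp: self_adjoint_def bounded_clinear_def)
  have F_lin: "bounded_linear F" and F_scaleC: "F (c *\<^sub>C x) = c *\<^sub>C F x" for c x
    using assms(10) by (auto simp: self_adjoint_def bounded_clinear_def)
  interpret F: bounded_linear F by (fact F_lin)
  have PP: "P \<alpha> (P \<beta> x) = 0" if "\<alpha> \<in> \<Lambda>" "\<beta> \<in> \<Lambda>" "\<alpha> \<noteq> \<beta>" for \<alpha> \<beta> x
    using assms(8)[OF that] by (simp add: fun_eq_iff)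
  have FP: "F (P \<alpha> x) = P \<alpha> (F x)" if "\<alpha> \<in> \<Lambda>" for \<alpha> x
    using assms(12)[OF that] by (simp add: fun_eq_iff)
  have P_nonzero: "\<exists>\<alpha>\<in>\<Lambda>. P \<alpha> x \<noteq> 0" if "x \<noteq> 0" for x
  proof (rule ccontr)
    assume "\<not> ?thesis"
    then have "((\<lambda>\<alpha>. P \<alpha> x) has_sum 0) \<Lambda>" by (intro has_sum_0) auto
    then show False using has_sum_unique[OF P_sum] that by blast
  qed
  obtain C where C: "0 < C" "\<And>\<alpha>. \<alpha> \<in> \<Lambda> \<Longrightarrow> \<bar>\<alpha>\<bar> \<le> C"
    using assms(4) by (auto simp: bounded_pos)

  \<comment> \<open>The diagonal operator \<open>D\<close>\<close>
  define D where "D x = (\<Sum>\<^sub>\<infinity>\<alpha>\<in>\<Lambda>. \<alpha> *\<^sub>R P \<alpha> x)" for x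
  have orth: "pairwise (\<lambda>\<alpha> \<beta>. orthogonal (P \<alpha> x) (P \<beta> x)) \<Lambda>" for x
    by (auto simp: pairwise_def orthogonal_def self_adjoint_inner[OF P_sa] PP)
  have summable: "(\<lambda>\<alpha>. \<alpha> *\<^sub>R P \<alpha> x) summable_on \<Lambda>"
    and D_bound: "norm (D x) \<le> C * norm x" for x
    using summable_on_scaleR_orthogonal[OF P_sum orth, of "\<lambda>\<alpha>. \<alpha>" C] C
    by (auto simp: D_def)
  have D_sum: "((\<lambda>\<alpha>. \<alpha> *\<^sub>R P \<alpha> x) has_sum D x) \<Lambda>" for x
    unfolding D_def using summable by (rule has_sum_infsum)
  \<comment> \<open>Applied to complex scalings, to \<open>F\<close> and to each
    \<open>P \<alpha>\<close>: a bounded operator passes through the series term by term.\<close>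
  have D_commute: "A (D x) = D (A x)"
    if "bounded_linear A" "\<And>\<alpha> x. \<alpha> \<in> \<Lambda> \<Longrightarrow> A (P \<alpha> x) = P \<alpha> (A x)" for A x
  proof -
    interpret A: bounded_linear A by fact
    have "((\<lambda>\<alpha>. A (\<alpha> *\<^sub>R P \<alpha> x)) has_sum A (D x)) \<Lambda>"
      using D_sum by (rule has_sum_bounded_linear[OF that(1)])
    then have "((\<lambda>\<alpha>. \<alpha> *\<^sub>R P \<alpha> (A x)) has_sum A (D x)) \<Lambda>"
      by (subst (asm) has_sum_cong) (auto simp: A.scaleR that(2))
    then show ?thesis using D_sum has_sum_unique by blast
  qed
  have D_scaleC: "D (c *\<^sub>C x) = c *\<^sub>C D x" for c x
    using D_commute[OF bounded_linear_scaleC, of c x] P_scaleC by metis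
  have D_add: "D (x + y) = D x + D y" for x y
  proof -
    have "((\<lambda>\<alpha>. \<alpha> *\<^sub>R P \<alpha> x + \<alpha> *\<^sub>R P \<alpha> y) has_sum D x + D y) \<Lambda>"
      by (intro has_sum_add D_sum)
    then have "((\<lambda>\<alpha>. \<alpha> *\<^sub>R P \<alpha> (x + y)) has_sum D x + D y) \<Lambda>"
      by (subst (asm) has_sum_cong)
        (auto simp: linear_add[OF bounded_linear.linear[OF P_lin]] scaleR_add_right)
    then show ?thesis using D_sum has_sum_unique by blast
  qed
  have D_lin: "bounded_linear D"
    by (rule bounded_linear_intro[where K = C])
      (simp_all add: D_add D_scaleC scaleR_scaleC D_bound mult.commute[of _ C])
  have D_sym: "D x \<bullet> y = x \<bullet> D y" for x y
  proof -
    have "((\<lambda>\<alpha>. (\<alpha> *\<^sub>R P \<alpha> x) \<bullet> y) has_sum D x \<bullet> y) \<Lambda>"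
      using D_sum by (rule has_sum_bounded_linear[OF bounded_linear_inner_left])
    moreover have "((\<lambda>\<alpha>. x \<bullet> (\<alpha> *\<^sub>R P \<alpha> y)) has_sum x \<bullet> D y) \<Lambda>"
      using D_sum by (rule has_sum_bounded_linear[OF bounded_linear_inner_right])
    then have "((\<lambda>\<alpha>. (\<alpha> *\<^sub>R P \<alpha> x) \<bullet> y) has_sum x \<bullet> D y) \<Lambda>"
      by (subst (asm) has_sum_cong) (auto simp: self_adjoint_inner[OF P_sa])
    ultimately show ?thesis by (rule has_sum_unique)
  qed
  have D_P: "D (P \<alpha> x) = \<alpha> *\<^sub>R P \<alpha> x" if "\<alpha> \<in> \<Lambda>" for \<alpha> x
  proof -
    have "((\<lambda>\<beta>. \<beta> *\<^sub>R P \<beta> (P \<alpha> x)) has_sum \<alpha> *\<^sub>R P \<alpha> x) \<Lambda>"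
      using that by (intro has_sum_finite_neutralI[of "{\<alpha>}"]) (auto simp: PP P_idem)
    then show ?thesis using D_sum has_sum_unique by blast
  qed

  \<comment> \<open>The operator \<open>T\<close>, its symmetry and its commutation
    relations\<close>
  define T where "T x = F x + D x" for x
  have T_lin: "bounded_linear T"
    unfolding T_def by (intro bounded_linear_add F_lin D_lin)
  interpret T: bounded_linear T by (fact T_lin)
  have T_scaleC: "T (c *\<^sub>C x) = c *\<^sub>C T x" for c x
    by (simp add: T_def F_scaleC D_scaleC scaleC_add_right)
  have T_sym: "T x \<bullet> y = x \<bullet> T y" for x y
    by (simp add: T_def inner_add_left inner_add_right D_sym self_adjoint_inner[OF assms(10)])
  have TP: "T (P \<alpha> x) = F (P \<alpha> x) + \<alpha> *\<^sub>R P \<alpha> x" if "\<alpha> \<in> \<Lambda>" for \<alpha> x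
    by (simp add: T_def D_P[OF that])
  have PT: "P \<alpha> (T x) = T (P \<alpha> x)" if "\<alpha> \<in> \<Lambda>" for \<alpha> x
  proof -
    have "P \<alpha> (D x) = D (P \<alpha> x)"
      by (rule D_commute[OF P_lin[OF that]]) (metis PP that)
    then show ?thesis
      by (simp add: T_def FP[OF that] linear_add[OF bounded_linear.linear[OF P_lin[OF that]]])
  qed
  have FT: "F (T x) = T (F x)" for x
    by (simp add: T_def F.add D_commute[OF F_lin FP])

  \<comment> \<open>Totality of the eigenvectors of \<open>T\<close>\<close>
  have total: "x = 0" if x: "\<And>e \<mu>. T e = \<mu> *\<^sub>R e \<Longrightarrow> x \<bullet> e = 0" for x
  proof (rule ccontr)
    \<comment> \<open>\<open>N\<close> is defined by the real inner product and real eigenvalues,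
      but it is a complex subspace, because complex multiples of eigenvectors again satisfy the
      eigenvalue equation.\<close>
    define N where "N = {x. \<forall>e \<mu>. T e = \<mu> *\<^sub>R e \<longrightarrow> x \<bullet> e = 0}"
    have N: "complex_vector.subspace N"
    proof -
      have "(c *\<^sub>C y) \<bullet> e = 0" if "y \<in> N" "T e = \<mu> *\<^sub>R e" for c y e \<mu>
      proof -
        have "T (cnj c *\<^sub>C e) = \<mu> *\<^sub>R (cnj c *\<^sub>C e)"
          by (simp add: T_scaleC that(2) scaleR_scaleC mult.commute)
        then show ?thesis using that(1) by (auto simp: N_def inner_scaleC_left)
      qed
      then show ?thesis
        by (auto simp: complex_vector.subspace_def N_def inner_add_left)
    qed
    \<comment> \<open>A symmetric operator commuting with \<open>T\<close> preserves the
      eigenspaces, hence also their common orthogonal complement.\<close>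
    have N_inv: "A y \<in> N"
      if "bounded_linear A" "\<And>x y. A x \<bullet> y = x \<bullet> A y" "\<And>x. A (T x) = T (A x)" "y \<in> N" for A y
    proof -
      interpret A: bounded_linear A by fact
      have "A y \<bullet> e = 0" if "T e = \<mu> *\<^sub>R e" for e \<mu>
      proof -
        have "T (A e) = \<mu> *\<^sub>R A e" using \<open>A (T e) = T (A e)\<close> that by (simp add: A.scaleR)
        then show ?thesis using \<open>y \<in> N\<close> by (auto simp: N_def \<open>A y \<bullet> e = y \<bullet> A e\<close>)
      qed
      then show ?thesis unfolding N_def by blast
    qed
    have no_eigenvector: "e = 0" if "e \<in> N" "T e = \<mu> *\<^sub>R e" for e \<mu>
      using that by (force simp: N_def)
    assume "x \<noteq> 0"
    then obtain \<alpha> where \<alpha>: "\<alpha> \<in> \<Lambda>" and nz: "P \<alpha> x \<noteq> 0" using P_nonzero by blast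
    have "x \<in> N" unfolding N_def using x by blast
    then have PN: "P \<alpha> x \<in> N"
      using N_inv[OF P_lin self_adjoint_inner[OF P_sa] PT, OF \<alpha> \<alpha> \<alpha>] by blast
    \<comment> \<open>Intersecting with \<open>range F\<close> makes \<open>S\<close>
      finite-dimensional; it is \<open>F\<close>-invariant, and \<open>T\<close> acts on it as
      \<open>F\<close> plus the scalar \<open>\<alpha>\<close>.\<close>
    define S where "S = {y \<in> N. P \<alpha> y = y} \<inter> range F"
    have FN: "F y \<in> N" if "y \<in> N" for y
      using N_inv[OF F_lin self_adjoint_inner[OF assms(10)] FT that] .
    have S: "complex_vector.subspace S"
      unfolding S_def
    proof (intro complex_vector.subspace_inter)
      show "complex_vector.subspace {y \<in> N. P \<alpha> y = y}"
        using N linear_add[OF bounded_linear.linear[OF P_lin[OF \<alpha>]]]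
          linear_0[OF bounded_linear.linear[OF P_lin[OF \<alpha>]]] P_scaleC[OF \<alpha>]
        by (auto simp: complex_vector.subspace_def)
      show "complex_vector.subspace (range F)"
        using rangeI[of F 0, unfolded F.zero]
        by (auto simp: complex_vector.subspace_def simp flip: F.add F_scaleC)
    qed
    have FS: "F y \<in> S" if "y \<in> N" "P \<alpha> y = y" for y
      using that FN FP[OF \<alpha>, of y] by (simp add: S_def)
    have "cfinite_dim S"
      using assms(11) by (auto simp: S_def finite_rank_def cfinite_dim_def)
    moreover have "F ` S \<subseteq> S" using FS by (auto simp: S_def)
    moreover have "F (P \<alpha> x) \<in> S" by (intro FS PN P_idem \<alpha>)
    \<comment> \<open>Otherwise \<open>P \<alpha> x\<close> would itself be an eigenvector of
      \<open>T\<close> in \<open>N\<close>, with eigenvalue \<open>\<alpha>\<close>. So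
      \<open>S\<close> is nonzero.\<close>
    moreover have "F (P \<alpha> x) \<noteq> 0"
      using no_eigenvector[OF PN, of \<alpha>] nz TP[OF \<alpha>, of x] by auto
    ultimately obtain e a where e: "e \<in> S" "e \<noteq> 0" "F e = a *\<^sub>C e"
      using exists_eigenvector[OF F.add F_scaleC S] by blast
    have "F e = Re a *\<^sub>R e" by (rule self_adjoint_eigenvalue_real[OF assms(10) e(3,2)])
    then have "T e = (Re a + \<alpha>) *\<^sub>R e"
      using e(1) TP[OF \<alpha>, of e] by (simp add: S_def scaleR_add_left)
    then show False using no_eigenvector e by (auto simp: S_def)
  qed

  \<comment> \<open>Eigenvalues of least modulus\<close>
  define \<Sigma> where "\<Sigma> = {\<mu>. \<exists>e. e \<noteq> 0 \<and> T e = \<mu> *\<^sub>R e}"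
  have "finite (\<Sigma> - \<Lambda>)"
  proof -
    obtain B where B: "finite B" "range F \<subseteq> span B"
      using assms(11) cfinite_dim_real_span by (auto simp: finite_rank_def)
    \<comment> \<open>Some component \<open>P \<alpha> e\<close> of an eigenvector for
      \<open>\<mu>\<close> is nonzero and again an eigenvector for \<open>\<mu>\<close>. There
      \<open>F\<close> acts as \<open>\<mu> - \<alpha>\<close>, nonzero as \<open>\<mu>\<close> lies
      outside \<open>\<Lambda>\<close>, so the component is in \<open>range F\<close>.\<close>
    have "\<Sigma> - \<Lambda> \<subseteq> {\<mu>. \<exists>e\<in>range F. e \<noteq> 0 \<and> T e = \<mu> *\<^sub>R e}"
    proof
      fix \<mu> assume "\<mu> \<in> \<Sigma> - \<Lambda>"
      then obtain e where e: "e \<noteq> 0" "T e = \<mu> *\<^sub>R e" and "\<mu> \<notin> \<Lambda>" by (auto simp: \<Sigma>_def)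
      obtain \<alpha> where \<alpha>: "\<alpha> \<in> \<Lambda>" and nz: "P \<alpha> e \<noteq> 0" using P_nonzero[OF e(1)] by blast
      have eig: "T (P \<alpha> e) = \<mu> *\<^sub>R P \<alpha> e"
        using PT[OF \<alpha>, of e] by (simp add: e(2) linear_scale[OF bounded_linear.linear[OF P_lin[OF \<alpha>]]])
      have "\<mu> - \<alpha> \<noteq> 0" using \<alpha> \<open>\<mu> \<notin> \<Lambda>\<close> by auto
      moreover have "F (P \<alpha> e) = (\<mu> - \<alpha>) *\<^sub>R P \<alpha> e"
        using eig TP[OF \<alpha>, of e] by (simp add: algebra_simps)
      ultimately have "F (inverse (\<mu> - \<alpha>) *\<^sub>R P \<alpha> e) = P \<alpha> e" by (simp add: F.scaleR)
      then have "P \<alpha> e \<in> range F" by (metis rangeI)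
      with eig nz show "\<mu> \<in> {\<mu>. \<exists>e\<in>range F. e \<noteq> 0 \<and> T e = \<mu> *\<^sub>R e}" by blast
    qed
    then show ?thesis using finite_eigenvalues[OF T_sym B] finite_subset by blast
  qed
  \<comment> \<open>Well-ordering enters here: well-foundedness of the strict order gives a minimal
    element, which is least because the order is linear.\<close>
  have \<Lambda>_least: "\<exists>m\<in>X. \<forall>y\<in>X. m \<le> y" if X: "X \<subseteq> \<Lambda>" "X \<noteq> {}" for X
  proof -
    let ?r = "{(\<alpha>, \<beta>). \<alpha> \<in> \<Lambda> \<and> \<beta> \<in> \<Lambda> \<and> \<alpha> \<le> \<beta>}"
    have "wf (?r - Id)" using assms(6) by (simp add: well_order_on_def)
    then obtain m where "m \<in> X" "\<And>y. (y, m) \<in> ?r - Id \<Longrightarrow> y \<notin> X"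
      using wfE_min'[OF _ X(2)] by blast
    then show ?thesis using X(1) by (intro bexI[of _ m]) force+
  qed
  have finite_least: "\<exists>m\<in>X. \<forall>y\<in>X. \<bar>m\<bar> \<le> \<bar>y\<bar>" if X: "finite X" "X \<noteq> {}" for X :: "real set"
  proof -
    have "Min (abs ` X) \<in> abs ` X" using X by simp
    then obtain m where "m \<in> X" "Min (abs ` X) = \<bar>m\<bar>" by (rule imageE)
    moreover have "Min (abs ` X) \<le> \<bar>y\<bar>" if "y \<in> X" for y using X that by simp
    ultimately show ?thesis by (intro bexI[of _ m]) auto
  qed
  have least: "\<exists>m\<in>X. \<forall>y\<in>X. \<bar>m\<bar> \<le> \<bar>y\<bar>" if X: "X \<subseteq> \<Sigma>" "X \<noteq> {}" for X
  proof -
    have fin: "finite (X - \<Lambda>)"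
      using \<open>finite (\<Sigma> - \<Lambda>)\<close> X(1) by (rule rev_finite_subset[OF _ Diff_mono[OF _ order_refl]])
    show ?thesis
    proof (cases "X \<inter> \<Lambda> = {}")
      case True
      then have "X - \<Lambda> = X" by blast
      then show ?thesis using finite_least[of X] fin X(2) by simp
    next
      case False
      \<comment> \<open>On \<open>\<Lambda>\<close> modulus and value agree, so \<open>m\<close>
        represents all of \<open>X \<inter> \<Lambda>\<close>; only finitely many competitors
        remain.\<close>
      obtain m where m: "m \<in> X \<inter> \<Lambda>" "\<And>y. y \<in> X \<inter> \<Lambda> \<Longrightarrow> m \<le> y"
        using \<Lambda>_least[OF Int_lower2 False] by blast
      obtain n where n: "n \<in> insert m (X - \<Lambda>)" "\<And>y. y \<in> insert m (X - \<Lambda>) \<Longrightarrow> \<bar>n\<bar> \<le> \<bar>y\<bar>"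
        using finite_least[of "insert m (X - \<Lambda>)"] fin by blast
      have "\<bar>n\<bar> \<le> \<bar>y\<bar>" if "y \<in> X" for y
      proof (cases "y \<in> \<Lambda>")
        case True
        have "m \<ge> 0" using m(1) assms(3) by auto
        then show ?thesis using n(2)[of m] m(2)[of y] that True by simp
      next
        case False
        then show ?thesis using n(2)[of y] that by simp
      qed
      moreover have "n \<in> X" using n(1) m(1) by auto
      ultimately show ?thesis by blast
    qed
  qed

  \<comment> \<open>Attainment on a reducing subspace\<close>
  have "min_attaining_on M T" if "M \<noteq> {0}" "reduces M T" for M
  proof -
    have M: "subspace M" "closed M" "T ` M \<subseteq> M"
      using that(2) complex_subspace_imp_subspace by (auto simp: reduces_def)
    define X where "X = {\<mu>. \<exists>e\<in>M. e \<noteq> 0 \<and> T e = \<mu> *\<^sub>R e}"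
    have "X \<noteq> {}"
    proof
      assume "X = {}"
      then have "e = 0" if "e \<in> M" "T e = \<mu> *\<^sub>R e" for e \<mu> using that by (auto simp: X_def)
      \<comment> \<open>Without nonzero eigenvectors in \<open>M\<close>, every element of
        \<open>M\<close> is trivially orthogonal to all of them.\<close>
      then have "x = 0" if "x \<in> M" for x
        using eq_0_of_orthogonal_eigenvectors_in[OF T_lin T_sym total M that] by force
      then show False using \<open>M \<noteq> {0}\<close> subspace_0[OF M(1)] by auto
    qed
    moreover have "X \<subseteq> \<Sigma>" by (auto simp: X_def \<Sigma>_def)
    ultimately have "\<exists>m\<in>X. \<forall>\<nu>\<in>X. \<bar>m\<bar> \<le> \<bar>\<nu>\<bar>" by (intro least)
    then obtain \<mu> where \<mu>: "\<mu> \<in> X" "\<forall>\<nu>\<in>X. \<bar>\<mu>\<bar> \<le> \<bar>\<nu>\<bar>" by (rule bexE)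
    obtain e where e: "e \<in> M" "e \<noteq> 0" "T e = \<mu> *\<^sub>R e" using \<mu>(1) by (auto simp: X_def)
    have lower: "\<bar>\<mu>\<bar> * norm x \<le> norm (T x)" if "x \<in> M" for x
      using \<mu>(2) by (intro lower_bound_of_eigenvalues[OF T_lin T_sym total M _ _ that])
        (auto simp: X_def)
    \<comment> \<open>This unit eigenvector gives the value \<open>\<bar>\<mu>\<bar>\<close>, and by
      \<open>lower\<close> no unit vector of \<open>M\<close> gives less.\<close>
    define u where "u = inverse (norm e) *\<^sub>R e"
    have u: "u \<in> M" "norm u = 1" "norm (T u) = \<bar>\<mu>\<bar>"
      using e M(1) by (auto simp: u_def subspace_scale T.scaleR abs_mult)
    have "min_modulus_on M T = norm (T u)"
      unfolding min_modulus_on_def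
    proof (rule cInf_eq_minimum)
      show "norm (T u) \<in> (\<lambda>x. norm (T x)) ` {x \<in> M. norm x = 1}" using u by blast
      show "norm (T u) \<le> y" if "y \<in> (\<lambda>x. norm (T x)) ` {x \<in> M. norm x = 1}" for y
        using that lower u(3) by fastforce
    qed
    with u show ?thesis by (auto simp: min_attaining_on_def)
  qed
  then have "T \<in> \<M>\<^sub>r"
    by (auto simp: min_attaining_reducing_def bounded_clinear_def T_lin T_scaleC)
  then show ?thesis using summable by (simp add: T_def[abs_def] D_def)
qed

end
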